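(* Let $G=\mathrm{GIRG}(n,\beta,w_0,d)$ be a standard GIRG with $\beta\ge3$ and $d=o(\log n)$. Then $\omega(G)=\Omega\big(\log n/(d+\log\log n)\big)$ asymptotically almost surely.
   Context: Fix constants $\lambda>0$, $w_0>0$, $\beta>2$. A standard GIRG $\mathrm{GIRG}(n,\beta,w_0,d)$ has $n$ vertices; each vertex $v$ independently receives a weight $w_v$ with $\Pr[w_v\le x]=1-(x/w_0)^{1-\beta}$ for $x\ge w_0$, and independently a position $\mathbf{x}_v$ uniform on the torus $\mathbb{T}^d=[0,1)^d$. The distance is $d(\mathbf{x}_u,\mathbf{x}_v)=\max_{1\le i\le d}|x_{ui}-x_{vi}|_C$ with $|a-b|_C=\min\{|a-b|,1-|a-b|\}$. Distinct $u,v$ are adjacent iff $d(\mathbf{x}_u,\mathbf{x}_v)\le \frac12\big(\frac{\lambda w_uw_v}{n}\big)^{1/d}$. The dimension $d=d(n)$ may depend on $n$. $\omega(G)$ is the size of the largest clique; "asymptotically almost surely" means with probability $1-o(1)$ as $n\to\infty$. *)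

theory Defs
  imports "HOL-Probability.Probability" "HOL-Library.Ramsey" "HOL-Library.Landau_Symbols"
begin

definition weight_cdf :: "real \<Rightarrow> real \<Rightarrow> real \<Rightarrow> real" where
  "weight_cdf \<beta> w0 x = (if x < w0 then 0 else 1 - (x / w0) powr (1 - \<beta>))"

definition weight_measure :: "real \<Rightarrow> real \<Rightarrow> real measure" where
  "weight_measure \<beta> w0 = interval_measure (weight_cdf \<beta> w0)"

text \<open>Points of the torus are functions on the coordinate set \<open>{..<d}\<close>, since the dimension
  varies with the number of vertices.\<close>

definition torus_measure :: "nat \<Rightarrow> (nat \<Rightarrow> real) measure" where
  "torus_measure d = (\<Pi>\<^sub>M i\<in>{..<d}. uniform_measure lborel {0..<1})"

definition circle_dist :: "real \<Rightarrow> real \<Rightarrow> real" where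
  "circle_dist a b = min \<bar>a - b\<bar> (1 - \<bar>a - b\<bar>)"

definition torus_dist :: "nat \<Rightarrow> (nat \<Rightarrow> real) \<Rightarrow> (nat \<Rightarrow> real) \<Rightarrow> real" where
  "torus_dist d x y = Max ((\<lambda>i. circle_dist (x i) (y i)) ` {..<d})"

text \<open>An outcome assigns to each vertex in \<open>{..<n}\<close> its weight and its position, all of them
  independent.\<close>

definition girg_space :: "nat \<Rightarrow> real \<Rightarrow> real \<Rightarrow> nat \<Rightarrow> (nat \<Rightarrow> real \<times> (nat \<Rightarrow> real)) measure" where
  "girg_space n \<beta> w0 d = (\<Pi>\<^sub>M v\<in>{..<n}. weight_measure \<beta> w0 \<Otimes>\<^sub>M torus_measure d)"

definition girg_edges ::
    "real \<Rightarrow> nat \<Rightarrow> nat \<Rightarrow> (nat \<Rightarrow> real \<times> (nat \<Rightarrow> real)) \<Rightarrow> nat set set" where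
  "girg_edges lam n d g =
     {{u, v} | u v. u < n \<and> v < n \<and> u \<noteq> v \<and>
        torus_dist d (snd (g u)) (snd (g v))
          \<le> 1 / 2 * (lam * fst (g u) * fst (g v) / real n) powr (1 / real d)}"

definition clique_number :: "'a set \<Rightarrow> 'a set set \<Rightarrow> nat" where
  "clique_number V E = Max {card S | S. S \<subseteq> V \<and> clique S E}"

lemma
  assumes "w0 > 0" "\<beta> > 1"
  shows prob_space_weight_measure: "prob_space (weight_measure \<beta> w0)"
    and measure_weight_measure_atMost: "measure (weight_measure \<beta> w0) {..x} = weight_cdf \<beta> w0 x"
proof -
  let ?F = "weight_cdf \<beta> w0"
  have F: "?F = (\<lambda>x. 1 - (max x w0 / w0) powr (1 - \<beta>))"
    using assms by (auto simp: weight_cdf_def max_def fun_eq_iff)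
  have mono: "?F x \<le> ?F y" if "x \<le> y" for x y
  proof -
    have "(max y w0 / w0) powr (1 - \<beta>) \<le> (max x w0 / w0) powr (1 - \<beta>)"
      using assms that by (intro powr_mono2' divide_right_mono max.mono) (auto simp: less_max_iff_disj)
    then show ?thesis unfolding F by simp
  qed
  have cont: "continuous (at_right a) ?F" for a
    using assms unfolding F by (intro continuous_intros) (auto simp: max_def)
  have bot: "(?F \<longlongrightarrow> 0) at_bot"
    by (rule tendsto_eventually)
       (auto simp: weight_cdf_def eventually_at_bot_linorder intro!: exI[of _ "w0 - 1"])
  have "((\<lambda>x. 1 - (x / w0) powr (1 - \<beta>)) \<longlongrightarrow> 1 - 0) at_top"
    using assms
    by (intro tendsto_diff tendsto_const tendsto_neg_powr)
       (auto intro!: filterlim_tendsto_pos_mult_at_top[OF tendsto_const] filterlim_ident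
             simp: divide_inverse mult.commute[of _ "inverse w0"])
  moreover have "eventually (\<lambda>x. 1 - (x / w0) powr (1 - \<beta>) = ?F x) at_top"
    by (auto simp: weight_cdf_def eventually_at_top_linorder intro!: exI[of _ w0])
  ultimately have top: "(?F \<longlongrightarrow> 1) at_top"
    using tendsto_cong by fastforce
  interpret real_distribution "interval_measure ?F"
    by (rule real_distribution_interval_measure) (use mono cont bot top in auto)
  show "prob_space (weight_measure \<beta> w0)"
    unfolding weight_measure_def by unfold_locales
  show "measure (weight_measure \<beta> w0) {..x} = ?F x"
    unfolding weight_measure_def using cdf_interval_measure[OF mono cont bot]
    by (simp add: cdf_def fun_eq_iff)
qed

lemma prob_space_torus_measure: "prob_space (torus_measure d)"
  unfolding torus_measure_def
  by (intro prob_space_PiM prob_space_uniform_measure) auto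

lemma prob_space_girg_space:
  assumes "w0 > 0" "\<beta> > 1"
  shows "prob_space (girg_space n \<beta> w0 d)"
proof -
  interpret W: prob_space "weight_measure \<beta> w0"
    using assms by (rule prob_space_weight_measure)
  interpret T: prob_space "torus_measure d"
    by (rule prob_space_torus_measure)
  interpret pair_prob_space "weight_measure \<beta> w0" "torus_measure d" ..
  show ?thesis
    unfolding girg_space_def by (intro prob_space_PiM) unfold_locales
qed

end

theory Submission
  imports Defs "HOL-Real_Asymp.Real_Asymp"
begin

text \<open>
  All weights are at least \<open>w0\<close>, so any set of vertices lying in one axis-parallel cube of side
  \<open>r = 1/2 (\<mu>/n)\<^bsup>1/d\<^esup>\<close>, where \<open>\<mu> = lam w0\<^sup>2\<close>, is a clique. The torus contains at
  least \<open>n/\<mu>\<close> disjoint such cubes, each of volume \<open>p = \<mu>/(2\<^sup>d n)\<close>, and it suffices that some cube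
  receives exactly \<open>k\<close> vertices. A second moment argument is applied to the events ``the vertices
  in cube \<open>i\<close> are exactly those in \<open>S\<close>'', over all cubes \<open>i\<close> and all \<open>k\<close>-sets \<open>S\<close>: two distinct
  events are either incompatible or correlated by a factor of at most \<open>(1 - p)\<^bsup>-2k\<^esup>\<close>, which
  tends to 1. The expected number of events that occur is at least of order
  \<open>n (\<mu>/(2\<^sup>d k))\<^sup>k\<close>, which exceeds \<open>\<surd>n\<close> up to a constant factor
  when \<open>k = c log n/(d + log log n)\<close> with \<open>c\<close> small.
\<close>

section \<open>Second moment method and exact occupancy of disjoint sets\<close>

text \<open>Let \<open>X\<close> count the events that occur. The quadratic 1 - (1 - tX)^2 is at
  most 1 and vanishes where X = 0, so its expectation is a lower bound for the probability of the
  union. In the second moment of \<open>X\<close> the diagonal pairs contribute \<open>s\<close> and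
  the others at most s^2 e.\<close>

lemma (in prob_space) second_moment_union_bound:
  fixes q e :: real
  assumes I: "finite I" and A: "\<And>a. a \<in> I \<Longrightarrow> A a \<in> events"
    and q: "\<And>a. a \<in> I \<Longrightarrow> prob (A a) = q"
    and e: "0 \<le> e"
    and joint: "\<And>a b. a \<in> I \<Longrightarrow> b \<in> I \<Longrightarrow> a \<noteq> b \<Longrightarrow> prob (A a \<inter> A b) \<le> e * q\<^sup>2"
  defines "s \<equiv> real (card I) * q"
  shows "prob (\<Union>a\<in>I. A a) \<ge> s / (1 + s * e)"
proof -
  define X where "X = (\<lambda>x. \<Sum>a\<in>I. indicat_real (A a) x)"
  have s: "0 \<le> s"
    unfolding s_def using q measure_nonneg[of M] by (cases "I = {}") (force intro!: mult_nonneg_nonneg)+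
  \<comment> \<open>The maximiser of \<open>2 t s - t\<^sup>2 (s + s\<^sup>2 e)\<close>, the bound on the probability obtained below.\<close>
  define t where "t = 1 / (1 + s * e)"
  have t: "t > 0" "t * (1 + s * e) = 1"
    using s e by (auto simp: t_def add_pos_nonneg add_nonneg_eq_0_iff)
  have int_ind: "integrable M (indicat_real B)" if "B \<in> events" for B
    using that by (simp add: emeasure_eq_measure)
  have EX: "expectation X = s" and intX: "integrable M X"
    unfolding X_def s_def using A q int_ind by (simp_all add: Bochner_Integration.integral_sum)
  have X2: "(X x)\<^sup>2 = (\<Sum>a\<in>I. \<Sum>b\<in>I. indicat_real (A a \<inter> A b) x)" for x
    by (simp add: X_def power2_eq_square sum_product indicator_inter_arith)
  have intX2: "integrable M (\<lambda>x. (X x)\<^sup>2)"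
    unfolding X2 using A int_ind by (intro Bochner_Integration.integrable_sum) auto
  have "expectation (\<lambda>x. (X x)\<^sup>2) = (\<Sum>a\<in>I. \<Sum>b\<in>I. prob (A a \<inter> A b))"
    unfolding X2 using A int_ind
    by (subst Bochner_Integration.integral_sum; (intro Bochner_Integration.integrable_sum)?)
       (auto intro!: sum.cong simp: Bochner_Integration.integral_sum)
  also have "\<dots> \<le> (\<Sum>a\<in>I. \<Sum>b\<in>I. (if a = b then q else 0) + e * q\<^sup>2)"
    using joint q e by (intro sum_mono) auto
  also have "\<dots> = s + s\<^sup>2 * e"
    using I by (simp add: sum.distrib s_def power2_eq_square algebra_simps)
  finally have EX2: "expectation (\<lambda>x. (X x)\<^sup>2) \<le> s + s\<^sup>2 * e" .
  have U: "(\<Union>a\<in>I. A a) \<in> events"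
    using I A by (intro sets.finite_UN) auto
  have pointwise: "2 * t * X x - t\<^sup>2 * (X x)\<^sup>2 \<le> indicat_real (\<Union>a\<in>I. A a) x" for x
  proof (cases "x \<in> (\<Union>a\<in>I. A a)")
    case True
    then show ?thesis using zero_le_power2[of "1 - t * X x"]
      by (simp add: power2_eq_square algebra_simps)
  next
    case False
    then have "X x = 0" by (auto simp: X_def)
    then show ?thesis by simp
  qed
  have "2 * t * s - t\<^sup>2 * (s + s\<^sup>2 * e) \<le> 2 * t * expectation X - t\<^sup>2 * expectation (\<lambda>x. (X x)\<^sup>2)"
    using EX EX2 by (simp add: mult_left_mono)
  also have "\<dots> = expectation (\<lambda>x. 2 * t * X x - t\<^sup>2 * (X x)\<^sup>2)"
    using intX intX2 by simp
  also have "\<dots> \<le> expectation (indicat_real (\<Union>a\<in>I. A a))"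
    using intX intX2 U int_ind pointwise by (intro integral_mono) auto
  also have "\<dots> = prob (\<Union>a\<in>I. A a)" using U by simp
  also have "2 * t * s - t\<^sup>2 * (s + s\<^sup>2 * e) = 2 * t * s - t * s * (t * (1 + s * e))"
    by (simp add: power2_eq_square algebra_simps)
  also have "\<dots> = s / (1 + s * e)" unfolding t(2) by (simp add: t_def)
  finally show ?thesis .
qed

text \<open>Two distinct events "exactly the elements of \<open>S\<close> land in
  \<open>B i\<close>" that can occur together have different indices and disjoint sets. Their joint
  probability is p^(2k) (1 - 2p)^(|V| - 2k), and 1 - 2p \<le> (1 - p)^2 bounds it by (1 - p)^(-2k)
  times the product of the two single probabilities.\<close>

lemma occupancy_lower_bound:
  fixes p :: real and k :: nat
  assumes M: "prob_space M" and V: "finite V" and J: "finite J"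
    and B: "\<And>i. i \<in> J \<Longrightarrow> B i \<in> sets M" and p: "\<And>i. i \<in> J \<Longrightarrow> measure M (B i) = p"
    and p1: "p < 1" and disj: "disjoint_family_on B J"
  defines "s \<equiv> real (card J) * real (card V choose k) * p ^ k * (1 - p) ^ (card V - k)"
  defines "N \<equiv> \<Pi>\<^sub>M v\<in>V. M"
  shows "measure N {g \<in> space N. \<exists>i\<in>J. card {v \<in> V. g v \<in> B i} = k} \<ge> s / (1 + s / (1 - p) ^ (2 * k))"
proof -
  interpret M: prob_space M by fact
  interpret P: finite_product_prob_space "\<lambda>_. M" V
    by unfold_locales (rule V)
  \<comment> \<open>As product sets, these events have probabilities that factor over
    \<open>V\<close>.\<close>
  define A where "A = (\<lambda>(i, S). \<Pi>\<^sub>E v\<in>V. if v \<in> S then B i else space M - B i)"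
  define I where "I = J \<times> {S. S \<subseteq> V \<and> card S = k}"
  define q where "q = p ^ k * (1 - p) ^ (card V - k)"
  have finI: "finite I" and cardI: "card I = card J * (card V choose k)"
    using V J by (auto simp: I_def card_cartesian_product n_subsets)
  have Bsp: "B i \<subseteq> space M" if "i \<in> J" for i
    using B[OF that] by (rule sets.sets_into_space)
  have prod_split: "(\<Prod>v\<in>V. if v \<in> S then x else y) = x ^ card S * y ^ (card V - card S)"
    if "S \<subseteq> V" for S and x y :: real
    using V that by (simp add: prod.If_cases Int_absorb1 card_Diff_subset finite_subset Diff_eq[symmetric])
  have evA: "A a \<in> P.events" if "a \<in> I" for a
    using that B V unfolding A_def I_def by (auto intro!: sets_PiM_I_finite)
  have probA: "P.prob (A a) = q" if a: "a \<in> I" for a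
  proof -
    obtain i S where a: "a = (i, S)" "i \<in> J" "S \<subseteq> V" "card S = k"
      using a by (auto simp: I_def)
    have "P.prob (A a) = (\<Prod>v\<in>V. M.prob (if v \<in> S then B i else space M - B i))"
      unfolding a A_def prod.case using B a by (intro P.prob_times) auto
    also have "\<dots> = (\<Prod>v\<in>V. if v \<in> S then p else 1 - p)"
      using B p a by (intro prod.cong) (auto simp: M.prob_compl)
    finally show ?thesis using a by (simp add: prod_split q_def)
  qed
  have joint: "P.prob (A a \<inter> A b) \<le> 1 / (1 - p) ^ (2 * k) * q\<^sup>2"
    if ab: "a \<in> I" "b \<in> I" "a \<noteq> b" for a b
  proof (cases "A a \<inter> A b = {}")
    case True
    then show ?thesis using p1 by simp
  next
    case False
    obtain i S j T where a: "a = (i, S)" "i \<in> J" "S \<subseteq> V" "card S = k"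
      and b: "b = (j, T)" "j \<in> J" "T \<subseteq> V" "card T = k"
      using ab by (auto simp: I_def)
    \<comment> \<open>A common outcome \<open>g\<close> recovers \<open>S\<close> and
      \<open>T\<close> as its preimages of \<open>B i\<close> and \<open>B j\<close>. Hence i = j
      would force S = T, and disjointness of \<open>B i\<close> and \<open>B j\<close> passes to
      \<open>S\<close> and \<open>T\<close>.\<close>
    from False obtain g where "g \<in> A a" "g \<in> A b" by auto
    then have g: "(g v \<in> B i) = (v \<in> S)" "(g v \<in> B j) = (v \<in> T)" if "v \<in> V" for v
      using that by (fastforce simp: A_def a b PiE_iff split: if_splits)+
    have ij: "i \<noteq> j"
    proof
      assume "i = j"
      with g have "S = T" using a(3) b(3) by blast
      with \<open>i = j\<close> ab a b show False by simp
    qed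
    have Bij: "B i \<inter> B j = {}" using disj a b ij by (auto simp: disjoint_family_on_def)
    have ST: "S \<inter> T = {}" using g Bij a b by blast
    have fS: "finite S" "finite T" using V a b finite_subset by auto
    have cST: "card (S \<union> T) = 2 * k" using card_Un_disjoint[OF fS ST] a b by simp
    have le: "2 * k \<le> card V" using card_mono[OF V, of "S \<union> T"] a b cST by simp
    have pij: "M.prob (space M - (B i \<union> B j)) = 1 - 2 * p"
      using a b B Bij p by (subst M.prob_compl) (auto simp: M.finite_measure_Union)
    \<comment> \<open>Raising 1 - 2p \<le> (1 - p)^2 to a power needs a nonnegative left side; it is
      one, being the probability of missing both sets.\<close>
    have p2: "0 \<le> 1 - 2 * p" using measure_nonneg[of M "space M - (B i \<union> B j)"] pij by simp
    have p0: "0 \<le> p" using p[OF a(2)] measure_nonneg by metis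
    have "A a \<inter> A b = (\<Pi>\<^sub>E v\<in>V. if v \<in> S then B i else if v \<in> T then B j else space M - (B i \<union> B j))"
      unfolding a b A_def prod.case PiE_Int using a b Bsp[of i] Bsp[of j] Bij ST
      by (intro PiE_cong) auto
    then have "P.prob (A a \<inter> A b) =
        (\<Prod>v\<in>V. M.prob (if v \<in> S then B i else if v \<in> T then B j else space M - (B i \<union> B j)))"
      using B a b by (auto intro!: P.prob_times)
    also have "\<dots> = (\<Prod>v\<in>V. if v \<in> S \<union> T then p else 1 - 2 * p)"
      using p a b pij by (intro prod.cong) auto
    also have "\<dots> = p ^ (2 * k) * (1 - 2 * p) ^ (card V - 2 * k)"
      using a b cST by (subst prod_split) auto
    also have "\<dots> \<le> p ^ (2 * k) * ((1 - p)\<^sup>2) ^ (card V - 2 * k)"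
      using p0 p2 by (intro mult_left_mono power_mono) (auto simp: power2_eq_square algebra_simps)
    also have "\<dots> = 1 / (1 - p) ^ (2 * k) * q\<^sup>2"
    proof -
      have "(1 - p) ^ (2 * (card V - k)) = (1 - p) ^ (2 * k) * (1 - p) ^ (2 * (card V - 2 * k))"
        using le by (simp flip: power_add add: algebra_simps)
      then show ?thesis using p1
        by (simp add: q_def power_mult_distrib mult.commute flip: power_mult)
    qed
    finally show ?thesis .
  qed
  have set_eq: "{g \<in> space N. \<exists>i\<in>J. card {v \<in> V. g v \<in> B i} = k} = (\<Union>a\<in>I. A a)"
  proof (intro equalityI subsetI)
    fix g assume "g \<in> {g \<in> space N. \<exists>i\<in>J. card {v \<in> V. g v \<in> B i} = k}"
    then obtain i where "i \<in> J" "card {v \<in> V. g v \<in> B i} = k" "g \<in> space N" by auto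
    then have "(i, {v \<in> V. g v \<in> B i}) \<in> I" "g \<in> A (i, {v \<in> V. g v \<in> B i})"
      by (auto simp: I_def A_def N_def space_PiM PiE_iff)
    then show "g \<in> (\<Union>a\<in>I. A a)" by blast
  next
    fix g assume "g \<in> (\<Union>a\<in>I. A a)"
    then obtain i S where a: "i \<in> J" "S \<subseteq> V" "card S = k" "g \<in> A (i, S)" by (auto simp: I_def)
    then have "{v \<in> V. g v \<in> B i} = S" by (force simp: A_def PiE_iff split: if_splits)
    moreover have "g \<in> space N"
      using a Bsp[OF a(1)] by (fastforce simp: A_def N_def space_PiM PiE_iff split: if_splits)
    ultimately show "g \<in> {g \<in> space N. \<exists>i\<in>J. card {v \<in> V. g v \<in> B i} = k}" using a by auto
  qed
  have "P.prob (\<Union>a\<in>I. A a) \<ge> real (card I) * q / (1 + real (card I) * q * (1 / (1 - p) ^ (2 * k)))"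
    using finI evA probA joint p1 by (intro P.second_moment_union_bound) auto
  moreover have "real (card I) * q = s" by (simp add: cardI s_def q_def)
  ultimately show ?thesis unfolding set_eq by (simp add: N_def)
qed


section \<open>Grid cells of the torus and the cliques inside them\<close>

text \<open>Half-open intervals make distinct cells disjoint. Building the weight bound into the
  cell lets it hold at every outcome rather than almost surely, at no cost in probability because
  the weight distribution has no atom at \<open>w0\<close>.\<close>

definition girg_cell :: "nat \<Rightarrow> real \<Rightarrow> real \<Rightarrow> (nat \<Rightarrow> nat) \<Rightarrow> (real \<times> (nat \<Rightarrow> real)) set" where
  "girg_cell d w0 r i = {w0<..} \<times> (\<Pi>\<^sub>E c\<in>{..<d}. {real (i c) * r ..< (real (i c) + 1) * r})"

lemma measure_torus_box:
  fixes a b :: "nat \<Rightarrow> real"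
  assumes "\<And>c. c < d \<Longrightarrow> 0 \<le> a c \<and> a c \<le> b c \<and> b c \<le> 1"
  shows "measure (torus_measure d) (\<Pi>\<^sub>E c\<in>{..<d}. {a c..<b c}) = (\<Prod>c<d. b c - a c)"
proof -
  interpret U: prob_space "uniform_measure lborel {0..<1::real}"
    by (rule prob_space_uniform_measure) auto
  interpret P: finite_product_prob_space "\<lambda>_. uniform_measure lborel {0..<1::real}" "{..<d}"
    by unfold_locales auto
  have "measure (uniform_measure lborel {0..<1}) {a c..<b c} = b c - a c" if "c < d" for c
  proof -
    have "{0..<1} \<inter> {a c..<b c} = {a c..<b c}" using assms[OF that] by auto
    then show ?thesis using assms[OF that] by (subst measure_uniform_measure) auto
  qed
  then show ?thesis unfolding torus_measure_def by (subst P.prob_times) auto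
qed

lemma sets_weight_measure [measurable_cong, simp]: "sets (weight_measure \<beta> w0) = sets borel"
  by (simp add: weight_measure_def)

lemma measure_weight_greaterThan:
  assumes "w0 > 0" "\<beta> > 1"
  shows "measure (weight_measure \<beta> w0) {w0<..} = 1"
proof -
  interpret W: prob_space "weight_measure \<beta> w0"
    using assms by (rule prob_space_weight_measure)
  have sp: "space (weight_measure \<beta> w0) = UNIV"
    using sets_eq_imp_space_eq[OF sets_weight_measure] by simp
  have "measure (weight_measure \<beta> w0) (space (weight_measure \<beta> w0) - {..w0}) = 1"
    using assms by (subst W.prob_compl) (auto simp: measure_weight_measure_atMost weight_cdf_def)
  moreover have "space (weight_measure \<beta> w0) - {..w0} = {w0<..}" by (auto simp: sp)
  ultimately show ?thesis by simp
qed

lemma torus_box_sets: "(\<Pi>\<^sub>E c\<in>{..<d}. {a c..<b c :: real}) \<in> sets (torus_measure d)"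
  unfolding torus_measure_def by (intro sets_PiM_I_finite) auto

lemma girg_cell_sets: "girg_cell d w0 r i \<in> sets (weight_measure \<beta> w0 \<Otimes>\<^sub>M torus_measure d)"
  unfolding girg_cell_def by (intro pair_measureI torus_box_sets) auto

text \<open>The bound \<open>real m * r \<le> 1\<close> keeps every grid cell inside the unit cube,
  so its volume is the full r^d; the weight factor contributes 1.\<close>

lemma measure_girg_cell:
  assumes w: "w0 > 0" "\<beta> > 1" and r: "r \<ge> 0" "real m * r \<le> 1"
    and i: "i \<in> {..<d} \<rightarrow>\<^sub>E {..<m}"
  shows "measure (weight_measure \<beta> w0 \<Otimes>\<^sub>M torus_measure d) (girg_cell d w0 r i) = r ^ d"
proof -
  interpret W: prob_space "weight_measure \<beta> w0"
    using w by (rule prob_space_weight_measure)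
  interpret T: prob_space "torus_measure d"
    by (rule prob_space_torus_measure)
  have le1: "(real (i c) + 1) * r \<le> 1" if "c < d" for c
  proof -
    have "i c < m" using i that by auto
    then have "real (i c) + 1 \<le> real m" by linarith
    then show ?thesis using r mult_right_mono[of "real (i c) + 1" "real m" r] by linarith
  qed
  have "measure (torus_measure d) (\<Pi>\<^sub>E c\<in>{..<d}. {real (i c) * r ..< (real (i c) + 1) * r}) = r ^ d"
    using r le1 by (subst measure_torus_box) (auto simp: algebra_simps)
  then show ?thesis
    using measure_weight_greaterThan[OF w] unfolding girg_cell_def measure_def
    by (subst T.emeasure_pair_measure_Times) (auto simp: torus_box_sets enn2real_mult)
qed

lemma disjoint_girg_cells:
  assumes r: "r > 0"
  shows "disjoint_family_on (girg_cell d w0 r) ({..<d} \<rightarrow>\<^sub>E X)"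
proof (unfold disjoint_family_on_def, intro ballI impI)
  fix i j assume ij: "i \<in> {..<d} \<rightarrow>\<^sub>E X" "j \<in> {..<d} \<rightarrow>\<^sub>E X" "i \<noteq> j"
  show "girg_cell d w0 r i \<inter> girg_cell d w0 r j = {}"
  proof (rule ccontr)
    assume "girg_cell d w0 r i \<inter> girg_cell d w0 r j \<noteq> {}"
    then obtain z where "z \<in> girg_cell d w0 r i" "z \<in> girg_cell d w0 r j" by blast
    then obtain x where x: "\<And>c. c < d \<Longrightarrow> x c \<in> {real (i c) * r ..< (real (i c) + 1) * r}"
      "\<And>c. c < d \<Longrightarrow> x c \<in> {real (j c) * r ..< (real (j c) + 1) * r}"
      by (cases z) (auto simp: girg_cell_def PiE_iff Ball_def)
    have "i c = j c" if "c < d" for c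
    proof -
      have "real (i c) * r < (real (j c) + 1) * r" "real (j c) * r < (real (i c) + 1) * r"
        using x[OF that] by auto
      \<comment> \<open>Intervals of equal length \<open>r\<close> that share a point have indices
        less than 1 apart, and the indices are integers.\<close>
      then have "real (i c) < real (j c) + 1" "real (j c) < real (i c) + 1"
        using r by simp_all
      then show ?thesis by linarith
    qed
    then have "i = j" using ij by (intro PiE_ext[of i "{..<d}" "\<lambda>_. X" j]) auto
    then show False using ij by simp
  qed
qed

lemma torus_dist_commute: "torus_dist d x y = torus_dist d y x"
  by (simp add: torus_dist_def circle_dist_def abs_minus_commute)

lemma edge_in_girg_edges_iff:
  "{u, v} \<in> girg_edges lam n d g \<longleftrightarrow> u < n \<and> v < n \<and> u \<noteq> v \<and>
     torus_dist d (snd (g u)) (snd (g v)) \<le> 1 / 2 * (lam * fst (g u) * fst (g v) / real n) powr (1 / real d)"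
  unfolding girg_edges_def
  by (auto simp: doubleton_eq_iff torus_dist_commute mult.commute mult.left_commute)

text \<open>The side \<open>r\<close> is exactly the connection radius of two vertices of the
  minimal weight \<open>w0\<close>. Larger weights only enlarge the radius, and wrapping around the
  circle only shortens distances.\<close>

lemma girg_cell_clique:
  assumes "lam > 0" "w0 > 0" "d \<ge> 1" "n > 0" and S: "S \<subseteq> {..<n}"
    and g: "\<And>v. v \<in> S \<Longrightarrow> g v \<in> girg_cell d w0 r i"
    and r: "r = 1 / 2 * (lam * w0\<^sup>2 / real n) powr (1 / real d)"
  shows "clique S (girg_edges lam n d g)"
  unfolding clique_def
proof (intro ballI impI)
  fix u v assume uv: "u \<in> S" "v \<in> S" "u \<noteq> v"
  have w: "w0 < fst (g u)" "w0 < fst (g v)"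
    and x: "\<And>c. c < d \<Longrightarrow> snd (g u) c \<in> {real (i c) * r ..< (real (i c) + 1) * r}"
      "\<And>c. c < d \<Longrightarrow> snd (g v) c \<in> {real (i c) * r ..< (real (i c) + 1) * r}"
    using g[OF uv(1)] g[OF uv(2)] by (auto simp: girg_cell_def PiE_iff mem_Times_iff)
  have "circle_dist (snd (g u) c) (snd (g v) c) \<le> r" if "c < d" for c
  proof -
    have "\<bar>snd (g u) c - snd (g v) c\<bar> \<le> r"
      using x[OF that] by (auto simp: abs_le_iff algebra_simps)
    then show ?thesis by (simp add: circle_dist_def)
  qed
  then have "torus_dist d (snd (g u)) (snd (g v)) \<le> r"
    unfolding torus_dist_def using assms(3) by (subst Max_le_iff) (auto simp: lessThan_empty_iff)
  also have "w0\<^sup>2 \<le> fst (g u) * fst (g v)"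
    using w assms(2) by (auto simp: power2_eq_square intro!: mult_mono)
  then have "r \<le> 1 / 2 * (lam * fst (g u) * fst (g v) / real n) powr (1 / real d)"
    unfolding r using assms(1,2,4)
    by (intro mult_left_mono powr_mono2 divide_right_mono) (auto simp: mult.assoc)
  finally show "{u, v} \<in> girg_edges lam n d g"
    using uv S by (auto simp: edge_in_girg_edges_iff)
qed

section \<open>Measurability of the clique number event\<close>

text \<open>The maximum is attained, since the clique sizes form a finite set that is nonempty
  thanks to the empty clique. The finite existential serves both the measurability proof and the
  lower bound from a single clique.\<close>

lemma le_clique_number_iff:
  fixes t :: real
  assumes "finite V"
  shows "t \<le> real (clique_number V E) \<longleftrightarrow> (\<exists>S\<in>Pow V. clique S E \<and> t \<le> real (card S))"
proof -
  let ?C = "{card S | S. S \<subseteq> V \<and> clique S E}"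
  have fin: "finite ?C" using assms by (auto intro!: finite_subset[of ?C "card ` Pow V"])
  have "?C \<noteq> {}" using null_clique by blast
  then have "Max ?C \<in> ?C" using fin by (intro Max_in) auto
  moreover have "card S \<le> Max ?C" if "S \<subseteq> V" "clique S E" for S
    using that fin by (intro Max_ge) auto
  ultimately show ?thesis unfolding clique_number_def
    by (smt (verit, best) Pow_iff mem_Collect_eq of_nat_le_iff)
qed

text \<open>The event is a finite union over vertex sets of finite intersections of edge events,
  each comparing two measurable functions. Monotonicity of the measure is later applied with this
  event as the larger set.\<close>

lemma clique_number_event_measurable:
  "{g \<in> space (girg_space n \<beta> w0 d). t \<le> real (clique_number {..<n} (girg_edges lam n d g))}
     \<in> sets (girg_space n \<beta> w0 d)"
proof -
  have comp: "(\<lambda>g. g v) \<in> girg_space n \<beta> w0 d \<rightarrow>\<^sub>M weight_measure \<beta> w0 \<Otimes>\<^sub>M torus_measure d" if "v < n" for v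
    unfolding girg_space_def using that by (intro measurable_component_singleton) auto
  have f: "(\<lambda>g. fst (g v)) \<in> borel_measurable (girg_space n \<beta> w0 d)" if "v < n" for v
    using measurable_compose[OF comp[OF that] measurable_fst] by (simp cong: measurable_cong_sets)
  have coord: "(\<lambda>x. x c) \<in> borel_measurable (torus_measure d)" if "c < d" for c
    using measurable_component_singleton[of c "{..<d}" "\<lambda>_. uniform_measure lborel {0..<1::real}"] that
    by (simp add: torus_measure_def cong: measurable_cong_sets)
  have x: "(\<lambda>g. snd (g v) c) \<in> borel_measurable (girg_space n \<beta> w0 d)" if "v < n" "c < d" for v c
    using measurable_compose[OF measurable_compose[OF comp[OF that(1)] measurable_snd] coord[OF that(2)]] .
  have dist: "(\<lambda>g. torus_dist d (snd (g u)) (snd (g v))) \<in> borel_measurable (girg_space n \<beta> w0 d)"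
    if "u < n" "v < n" for u v
    unfolding torus_dist_def circle_dist_def using x[OF that(1)] x[OF that(2)]
    by (intro borel_measurable_Max borel_measurable_min borel_measurable_diff borel_measurable_abs) auto
  have edge: "{g \<in> space (girg_space n \<beta> w0 d). {u, v} \<in> girg_edges lam n d g} \<in> sets (girg_space n \<beta> w0 d)"
    if "u < n" "v < n" for u v
  proof -
    have "{g \<in> space (girg_space n \<beta> w0 d). torus_dist d (snd (g u)) (snd (g v))
        \<le> 1 / 2 * (lam * fst (g u) * fst (g v) / real n) powr (1 / real d)} \<in> sets (girg_space n \<beta> w0 d)"
      using dist[OF that] f[OF that(1)] f[OF that(2)]
      by (intro borel_measurable_le borel_measurable_times powr_real_measurable borel_measurable_divide
          borel_measurable_const)
    moreover have "{g \<in> space (girg_space n \<beta> w0 d). {u, v} \<in> girg_edges lam n d g} =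
        (if u = v then {} else {g \<in> space (girg_space n \<beta> w0 d). torus_dist d (snd (g u)) (snd (g v))
        \<le> 1 / 2 * (lam * fst (g u) * fst (g v) / real n) powr (1 / real d)})"
      using that by (simp only: edge_in_girg_edges_iff) simp
    ultimately show ?thesis by (simp only: sets.empty_sets simp_thms split: if_split)
  qed
  have pair: "{g \<in> space (girg_space n \<beta> w0 d). u \<noteq> v \<longrightarrow> {u, v} \<in> girg_edges lam n d g}
      \<in> sets (girg_space n \<beta> w0 d)" if "u < n" "v < n" for u v
    using edge[OF that] by (cases "u = v") simp_all
  have clq: "{g \<in> space (girg_space n \<beta> w0 d). clique S (girg_edges lam n d g)}
      \<in> sets (girg_space n \<beta> w0 d)" if S: "S \<subseteq> {..<n}" for S
  proof -
    have fin: "finite S" using S finite_subset by blast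
    show ?thesis unfolding clique_def
    proof (rule sets.sets_Collect_finite_All[OF _ fin], rule sets.sets_Collect_finite_All[OF _ fin])
      fix u v assume "u \<in> S" "v \<in> S"
      with S show "{g \<in> space (girg_space n \<beta> w0 d). u \<noteq> v \<longrightarrow> {u, v} \<in> girg_edges lam n d g}
          \<in> sets (girg_space n \<beta> w0 d)" by (intro pair) auto
    qed
  qed
  have "{g \<in> space (girg_space n \<beta> w0 d). \<exists>S\<in>Pow {..<n}. clique S (girg_edges lam n d g) \<and> t \<le> real (card S)}
      \<in> sets (girg_space n \<beta> w0 d)"
  proof (rule sets.sets_Collect_finite_Ex)
    fix S assume "S \<in> Pow {..<n}"
    then show "{g \<in> space (girg_space n \<beta> w0 d). clique S (girg_edges lam n d g) \<and> t \<le> real (card S)}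
        \<in> sets (girg_space n \<beta> w0 d)"
      using clq[of S] by (cases "t \<le> real (card S)") simp_all
  qed simp
  then show ?thesis by (simp add: le_clique_number_iff)
qed

section \<open>Estimates for fixed \<open>n\<close>\<close>

text \<open>There are at least n/\<mu> cells and the binomial coefficient is at least (n/k)^k, so
  the product without its last factor is at least (n/\<mu>) (\<mu>/(2^d k))^k. By
  \<open>small\<close> the k-th power is at least n^(-1/2).\<close>

lemma girg_occupancy_estimate:
  fixes \<mu> r :: real and n d k m :: nat
  assumes \<mu>: "\<mu> > 0" "\<mu> < real n" and k: "1 \<le> k" "k \<le> n" and d: "d \<ge> 1"
    and r: "r = 1 / 2 * (\<mu> / real n) powr (1 / real d)" and m: "m = nat \<lfloor>1 / r\<rfloor>"
    and small: "real k * (real d + ln (real k) + \<bar>ln \<mu>\<bar>) \<le> ln (real n) / 2"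
  shows "r > 0" "real m * r \<le> 1" "r ^ d \<le> \<mu> / real n"
    and "real (m ^ d) * real (n choose k) * (r ^ d) ^ k * (1 - r ^ d) ^ (n - k)
           \<ge> sqrt (real n) / \<mu> * (1 - \<mu> / real n) ^ n"
proof -
  have n: "real n > 0" using \<mu> by linarith
  show r0: "r > 0" using \<mu> n by (simp add: r)
  have root: "((\<mu> / real n) powr (1 / real d)) ^ d = \<mu> / real n"
    using \<mu> n d by (simp add: powr_power)
  have rd: "r ^ d = \<mu> / (real n * 2 ^ d)"
    unfolding r power_mult_distrib root by (simp add: power_divide)
  have "\<mu> / (real n * 2 ^ d) \<le> \<mu> / (real n * 1)"
    using \<mu> n by (intro divide_left_mono mult_left_mono) auto
  then show rd_le: "r ^ d \<le> \<mu> / real n" by (simp add: rd)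
  have "real m \<le> 1 / r" unfolding m using r0 by (simp add: of_nat_nat)
  then show "real m * r \<le> 1" using r0 by (simp add: field_simps)
  have "(\<mu> / real n) powr (1 / real d) \<le> 1"
    using \<mu> n by (intro powr_le1) auto
  then have "2 * r \<le> 1" by (simp add: r)
  then have "1 / r \<ge> 2" using r0 by (simp add: field_simps)
  \<comment> \<open>Rounding 1/r down costs at most a factor 2 per coordinate, which the factor 1/2
    in \<open>r\<close> compensates: (1/(2r))^d is exactly n/\<mu>.\<close>
  then have "real m \<ge> 1 / (2 * r)" unfolding m using r0 by (simp add: of_nat_nat) linarith
  then have "real m ^ d \<ge> (1 / (2 * r)) ^ d" using r0 by (intro power_mono) auto
  also have "(1 / (2 * r)) ^ d = real n / \<mu>"
    using root by (simp add: r power_divide)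
  finally have md: "real (m ^ d) \<ge> real n / \<mu>" by simp
  have "sqrt (real n) / \<mu> = real n / \<mu> * exp (- (ln (real n) / 2))"
  proof -
    have "exp (- (ln (real n) / 2)) = 1 / sqrt (real n)"
      using n by (simp add: exp_minus ln_sqrt[symmetric] inverse_eq_divide)
    moreover have "real n / \<mu> * (1 / sqrt (real n)) = real n / sqrt (real n) / \<mu>" by simp
    ultimately show ?thesis by (simp only: real_div_sqrt of_nat_0_le_iff)
  qed
  also have "\<dots> \<le> real n / \<mu> * exp (real k * (ln \<mu> - real d * ln 2 - ln (real k)))"
  proof -
    have "ln 2 \<le> (1::real)" using ln_2_less_1 by simp
    then have "real d * ln 2 \<le> real d" by (simp add: mult_left_le)
    then have "- (real d + ln (real k) + \<bar>ln \<mu>\<bar>) \<le> ln \<mu> - real d * ln 2 - ln (real k)" by linarith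
    then have "real k * - (real d + ln (real k) + \<bar>ln \<mu>\<bar>) \<le> real k * (ln \<mu> - real d * ln 2 - ln (real k))"
      by (rule mult_left_mono) simp
    then have "- (ln (real n) / 2) \<le> real k * (ln \<mu> - real d * ln 2 - ln (real k))"
      using small by (simp only: mult_minus_right)
    then show ?thesis using \<mu> by (intro mult_left_mono) auto
  qed
  also have "exp (real k * (ln \<mu> - real d * ln 2 - ln (real k))) = (\<mu> / (2 ^ d * real k)) ^ k"
    using \<mu> k by (simp add: exp_of_nat_mult exp_diff exp_of_nat_mult)
  also have "\<dots> = (real n / real k) ^ k * (r ^ d) ^ k"
    using n by (simp add: rd mult.commute flip: power_mult_distrib)
  also have "real n / \<mu> * \<dots> \<le> real (m ^ d) * (real (n choose k) * (r ^ d) ^ k)"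
    using \<mu> n md binomial_ge_n_over_k_pow_k[OF k(2), where 'a = real] r0
    by (intro mult_mono mult_nonneg_nonneg) auto
  finally have A: "sqrt (real n) / \<mu> \<le> real (m ^ d) * real (n choose k) * (r ^ d) ^ k"
    by (simp add: mult.assoc)
  \<comment> \<open>Enlarging the exponent to \<open>n\<close> and the cell volume to \<mu>/n frees
    this factor from \<open>k\<close> and \<open>d\<close>.\<close>
  have "(1 - \<mu> / real n) ^ n \<le> (1 - \<mu> / real n) ^ (n - k)"
    using \<mu> n by (intro power_decreasing) auto
  also have "\<dots> \<le> (1 - r ^ d) ^ (n - k)"
    using rd_le \<mu> n by (intro power_mono) auto
  finally show "real (m ^ d) * real (n choose k) * (r ^ d) ^ k * (1 - r ^ d) ^ (n - k)
           \<ge> sqrt (real n) / \<mu> * (1 - \<mu> / real n) ^ n"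
    using A \<mu> n r0 by (intro mult_mono) auto
qed

text \<open>The bound involves only \<open>n\<close> and \<mu>, so its limit can be taken whatever
  the dimension does. The occupancy bound has the form s/(1 + s e) = 1/(1/s + 1/y) with y = 1/e,
  which increases in \<open>s\<close> and in \<open>y\<close>; both are replaced by lower
  bounds.\<close>

lemma girg_clique_probability:
  fixes lam w0 \<beta> :: real and n d k :: nat
  assumes "lam > 0" "w0 > 0" "\<beta> > 1" "d \<ge> 1"
  defines "\<mu> \<equiv> lam * w0\<^sup>2"
  assumes n: "\<mu> < real n" "2 * ln (real n) * (\<mu> / real n) < 1"
    and k: "1 \<le> k" "k \<le> n" "real k \<le> ln (real n)" "t \<le> real k"
    and small: "real k * (real d + ln (real k) + \<bar>ln \<mu>\<bar>) \<le> ln (real n) / 2"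
  defines "s \<equiv> sqrt (real n) / \<mu> * (1 - \<mu> / real n) ^ n"
  shows "measure (girg_space n \<beta> w0 d)
      {g \<in> space (girg_space n \<beta> w0 d). t \<le> real (clique_number {..<n} (girg_edges lam n d g))}
      \<ge> 1 / (1 / s + 1 / (1 - 2 * ln (real n) * (\<mu> / real n)))"
proof -
  define r where "r = 1 / 2 * (\<mu> / real n) powr (1 / real d)"
  define m where "m = nat \<lfloor>1 / r\<rfloor>"
  define J where "J = ({..<d} \<rightarrow>\<^sub>E {..<m})"
  define s' where "s' = real (card J) * real (n choose k) * (r ^ d) ^ k * (1 - r ^ d) ^ (n - k)"
  have \<mu>: "\<mu> > 0" using assms(1,2) by (simp add: \<mu>_def)
  have n0: "real n > 0" using n \<mu> by linarith
  note est = girg_occupancy_estimate[OF \<mu> n(1) k(1,2) assms(4) r_def m_def small]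
  have cardJ: "card J = m ^ d" by (simp add: J_def card_PiE)
  have s: "s > 0" "s \<le> s'"
    using est(4) \<mu> n n0 by (auto simp: s_def s'_def cardJ)
  have p1: "r ^ d < 1" using est(3) n n0 by (smt (verit) divide_less_eq_1_pos)
  interpret W: prob_space "weight_measure \<beta> w0"
    using assms(2,3) by (rule prob_space_weight_measure)
  interpret T: prob_space "torus_measure d"
    by (rule prob_space_torus_measure)
  interpret WT: pair_prob_space "weight_measure \<beta> w0" "torus_measure d" ..
  interpret G: prob_space "girg_space n \<beta> w0 d"
    using assms(2,3) by (rule prob_space_girg_space)
  \<comment> \<open>Bernoulli's inequality, with k \<le> ln n and cell volume at most \<mu>/n,
    bounds the correlation factor.\<close>
  have "1 - 2 * ln (real n) * (\<mu> / real n) \<le> 1 + real (2 * k) * (- (r ^ d))"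
    using est(1,3) k(3) \<mu> n0 mult_mono[of "2 * real k" "2 * ln (real n)" "r ^ d" "\<mu> / real n"] by simp
  also have "\<dots> \<le> (1 + - (r ^ d)) ^ (2 * k)"
    using p1 by (intro Bernoulli_inequality) auto
  finally have y: "1 - 2 * ln (real n) * (\<mu> / real n) \<le> (1 - r ^ d) ^ (2 * k)" by simp
  have "1 / (1 / s + 1 / (1 - 2 * ln (real n) * (\<mu> / real n))) \<le> 1 / (1 / s' + 1 / (1 - r ^ d) ^ (2 * k))"
    using s y n(2) p1 by (intro divide_left_mono add_mono mult_pos_pos add_pos_pos) auto
  also have "\<dots> = s' / (1 + s' / (1 - r ^ d) ^ (2 * k))"
    using s p1 by (simp add: divide_simps)
  also have "\<dots> \<le> measure (girg_space n \<beta> w0 d)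
      {g \<in> space (girg_space n \<beta> w0 d). \<exists>i\<in>J. card {v \<in> {..<n}. g v \<in> girg_cell d w0 r i} = k}"
    using occupancy_lower_bound[OF WT.prob_space_axioms, of "{..<n}" J "girg_cell d w0 r" "r ^ d" k]
      est(1,2) assms(2,3) p1
    by (simp add: girg_space_def s'_def J_def finite_PiE girg_cell_sets measure_girg_cell disjoint_girg_cells
        del: sets_weight_measure)
  also have "\<dots> \<le> measure (girg_space n \<beta> w0 d)
      {g \<in> space (girg_space n \<beta> w0 d). t \<le> real (clique_number {..<n} (girg_edges lam n d g))}"
  proof (rule G.finite_measure_mono[OF _ clique_number_event_measurable], intro subsetI CollectI conjI)
    fix g assume g: "g \<in> {g \<in> space (girg_space n \<beta> w0 d).
        \<exists>i\<in>J. card {v \<in> {..<n}. g v \<in> girg_cell d w0 r i} = k}"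
    then show "g \<in> space (girg_space n \<beta> w0 d)" by simp
    from g obtain i where i: "card {v \<in> {..<n}. g v \<in> girg_cell d w0 r i} = k" by auto
    have "clique {v \<in> {..<n}. g v \<in> girg_cell d w0 r i} (girg_edges lam n d g)"
      using assms(1,2,4) n0 by (intro girg_cell_clique[of lam w0 d n _ g r i]) (auto simp: r_def \<mu>_def)
    then show "t \<le> real (clique_number {..<n} (girg_edges lam n d g))"
      using i k(4) by (subst le_clique_number_iff) auto
  qed
  finally show ?thesis .
qed

section \<open>Choice of the clique size and passage to the limit\<close>

theorem theorem20:
  fixes lam w0 \<beta> :: real and d :: "nat \<Rightarrow> nat"
  assumes "lam > 0" and "w0 > 0" and "\<beta> \<ge> 3"
    and "\<And>n. d n \<ge> 1"
    and "(\<lambda>n. real (d n)) \<in> o(\<lambda>n. ln (real n))"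
  shows "\<exists>c>0. (\<lambda>n. measure (girg_space n \<beta> w0 (d n))
            {g \<in> space (girg_space n \<beta> w0 (d n)).
               real (clique_number {..<n} (girg_edges lam n (d n) g))
                 \<ge> c * (ln (real n) / (real (d n) + ln (ln (real n))))})
          \<longlonglongrightarrow> 1"
proof -
  define \<mu> where "\<mu> = lam * w0\<^sup>2"
  \<comment> \<open>The 4 pays for a factor 2 from rounding the clique size up and for the 1/2 in
    the size condition; 1 + |ln \<mu>| absorbs the term |ln \<mu>|.\<close>
  define c where "c = 1 / (4 * (1 + \<bar>ln \<mu>\<bar>))"
  define P where "P = (\<lambda>n. measure (girg_space n \<beta> w0 (d n))
            {g \<in> space (girg_space n \<beta> w0 (d n)).
               real (clique_number {..<n} (girg_edges lam n (d n) g))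
                 \<ge> c * (ln (real n) / (real (d n) + ln (ln (real n))))})"
  define a where "a = (\<lambda>n. 1 / (1 / (sqrt (real n) / \<mu> * (1 - \<mu> / real n) ^ n)
      + 1 / (1 - 2 * ln (real n) * (\<mu> / real n))))"
  have \<mu>: "\<mu> > 0" using assms(1,2) by (simp add: \<mu>_def)
  have c: "c > 0" "c \<le> 1 / 4" "c * (1 + \<bar>ln \<mu>\<bar>) = 1 / 4"
    unfolding c_def by (auto simp: field_simps add_pos_nonneg)
  \<comment> \<open>Here (1 - \<mu>/n)^n tends to exp(-\<mu>) while the square root diverges, and
    (ln n)/n tends to 0.\<close>
  have a: "a \<longlonglongrightarrow> 1" unfolding a_def using \<mu> by real_asymp
  \<comment> \<open>With c/2 for each of d and ln ln n, the denominator \<open>D\<close> is at most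
    cL. Hence x \<ge> 1, and rounding \<open>x\<close> up at most doubles it.\<close>
  have "eventually (\<lambda>n. norm (real (d n)) \<le> c / 2 * norm (ln (real n))) sequentially"
    using landau_o.smallD[OF assms(5), of "c / 2"] c by simp
  moreover have "eventually (\<lambda>n. ln (ln (real n)) \<le> c / 2 * ln (real n)) sequentially"
    "eventually (\<lambda>n. 0 \<le> ln (ln (real n))) sequentially"
    "eventually (\<lambda>n. 0 < ln (real n)) sequentially"
    "eventually (\<lambda>n. \<mu> < real n) sequentially"
    "eventually (\<lambda>n. 2 * ln (real n) * (\<mu> / real n) < 1) sequentially"
    "eventually (\<lambda>n. ln (real n) \<le> real n) sequentially"
    using c \<mu> by real_asymp+
  ultimately have "eventually (\<lambda>n. a n \<le> P n) sequentially"
  proof eventually_elim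
    case (elim n)
    define L where "L = ln (real n)"
    define D where "D = real (d n) + ln L"
    define x where "x = c * (L / D)"
    define k where "k = nat \<lceil>x\<rceil>"
    have d1: "real (d n) \<ge> 1" using assms(4)[of n] by simp
    have L: "L > 0" "0 \<le> ln L" "D \<le> c * L" "D \<ge> 1"
    proof -
      show "L > 0" "0 \<le> ln L" using elim by (simp_all only: L_def)
      then show "D \<ge> 1" using d1 unfolding D_def by linarith
      have "real (d n) \<le> c / 2 * L" "ln L \<le> c / 2 * L" using elim \<open>L > 0\<close> by (simp_all add: L_def)
      then show "D \<le> c * L" by (simp add: D_def)
    qed
    have x1: "x \<ge> 1" using L by (simp add: x_def field_simps)
    have kx: "x \<le> real k" "real k \<le> 2 * x" "1 \<le> k"
      unfolding k_def using x1 by linarith+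
    have kD: "real k * D \<le> 2 * c * L"
    proof -
      have "real k * D \<le> 2 * x * D" using kx L by (intro mult_right_mono) auto
      then show ?thesis using L by (simp add: x_def)
    qed
    have "real k \<le> real k * D" using L by (simp add: mult_le_cancel_left1)
    also have "\<dots> \<le> L" using kD c L mult_right_mono[of c "1/4" L] by linarith
    finally have kL: "real k \<le> L" .
    \<comment> \<open>Since k \<le> ln n, the term ln k is dominated by the ln ln n in
      \<open>D\<close>; then D \<ge> 1 turns the additive |ln \<mu>| into a factor.\<close>
    have "ln (real k) \<le> ln L" using kL kx by simp
    then have "real (d n) + ln (real k) + \<bar>ln \<mu>\<bar> \<le> D + \<bar>ln \<mu>\<bar>" by (simp add: D_def)
    also have "\<dots> \<le> D * (1 + \<bar>ln \<mu>\<bar>)" using L by (simp add: algebra_simps mult_le_cancel_right1)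
    finally have "real k * (real (d n) + ln (real k) + \<bar>ln \<mu>\<bar>) \<le> real k * D * (1 + \<bar>ln \<mu>\<bar>)"
      by (simp add: mult_left_mono mult.assoc)
    also have "\<dots> \<le> 2 * c * L * (1 + \<bar>ln \<mu>\<bar>)" using kD by (intro mult_right_mono) auto
    also have "\<dots> = 2 * L * (c * (1 + \<bar>ln \<mu>\<bar>))" by (simp add: mult_ac)
    also have "\<dots> = ln (real n) / 2" unfolding c(3) by (simp add: L_def)
    finally have small: "real k * (real (d n) + ln (real k) + \<bar>ln \<mu>\<bar>) \<le> ln (real n) / 2" .
    have "k \<le> n" using kL elim by (simp add: L_def)
    then show ?case
      using girg_clique_probability[of lam w0 \<beta> "d n" n k x] assms elim kx kL small
      by (simp add: a_def P_def \<mu>_def x_def D_def L_def)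
  qed
  moreover have "P n \<le> 1" for n
  proof -
    interpret prob_space "girg_space n \<beta> w0 (d n)"
      using assms by (intro prob_space_girg_space) auto
    show ?thesis by (simp add: P_def)
  qed
  ultimately have "P \<longlonglongrightarrow> 1"
    by (intro tendsto_sandwich[OF _ _ a tendsto_const]) auto
  then show ?thesis using c(1) unfolding P_def by blast
qed

end
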